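(* Assume that $T$ is finite and let $(\bar c,\bar b)\in\mathbb{R}^p\times\mathbb{R}^T$ and $\bar x\in\mathcal{S}(\bar c,\bar b)$. Then $$\mathrm{clm}\,\mathcal{S}\big((\bar c,\bar b),\bar x\big)\ =\ \mathrm{clm}\,\mathcal{S}_{\bar c}(\bar b,\bar x)\ \le\ \sup_{D\in\mathcal{K}_{\bar b}(\bar x)}\ \limsup_{\substack{x\to\bar x\\ f_D(x)>0}}\ \frac{1}{d_*\big(0_p,\partial f_D(x)\big)}.$$
   Context: Setting: $T$ is a finite index set, $a_t\in\mathbb{R}^p$ ($t\in T$) are fixed vectors, and $b=(b_t)_{t\in T}\in\mathbb{R}^T$ with $\|b\|_\infty=\max_{t\in T}|b_t|$. $\mathbb{R}^p$ carries an arbitrary norm $\|\cdot\|$ with dual norm $\|u\|_*=\max_{\|x\|\le1}\langle u,x\rangle$; $d_*$ is the distance associated with $\|\cdot\|_*$ (including point-to-set distance), and $0_p$ is the zero vector of $\mathbb{R}^p$. For $(c,b)\in\mathbb{R}^p\times\mathbb{R}^T$, $P(c,b)$ is the problem: minimize $\langle c,x\rangle$ subject to $\langle a_t,x\rangle\le b_t$ for all $t\in T$. The parameter space has norm $\|(c,b)\|=\max\{\|c\|_*,\|b\|_\infty\}$. $\mathcal{S}(c,b)\subset\mathbb{R}^p$ is the set of optimal solutions of $P(c,b)$, and for fixed $c$, $\mathcal{S}_c(b):=\mathcal{S}(c,b)$ as a set-valued mapping of $b\in\mathbb{R}^T$. Calmness modulus: for a set-valued mapping $S$ from a metric space $(Y,d_Y)$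 to a metric space $(X,d_X)$ and $\bar x\in S(\bar y)$, $\mathrm{clm}\,S(\bar y,\bar x)\in[0,\infty]$ is the infimum of all $\kappa\ge0$ for which there are neighborhoods $U$ of $\bar x$ and $V$ of $\bar y$ with $d_X(x,S(\bar y))\le\kappa\, d_Y(y,\bar y)$ whenever $y\in V$ and $x\in S(y)\cap U$ (it is $+\infty$ if no such $\kappa$ exists). Active indices: $T_b(x)=\{t\in T:\langle a_t,x\rangle=b_t\}$ for feasible $x$. $\mathrm{cone}(X)$ is the conical convex hull of $X$, always containing $0$ (so $\mathrm{cone}(\emptyset)=\{0_p\}$). Define $$\mathcal{K}_{\bar b}(\bar x)=\{D\subset T_{\bar b}(\bar x): |D|\le p,\ -\bar c\in\mathrm{cone}\{a_t: t\in D\}\}.$$ For $D\in\mathcal{K}_{\bar b}(\bar x)$, the convex function $f_D:\mathbb{R}^p\to\mathbb{R}$ is $$f_D(x)=\sup\big\{\langle a_t,x\rangle-\bar b_t,\ t\in T;\ -\langle a_t,x\rangle+\bar b_t,\ t\in D\big\},$$ and $\partial f_D(x)$ is its convex subdifferential. If there are no points $x$ with $f_D(x)>0$ arbitrarily close to $\bar x$, the corresponding $\limsup$ is understood as $0$. *)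

theory Defs
  imports "HOL-Analysis.Analysis"
begin

definition is_norm :: "('a::real_vector \<Rightarrow> real) \<Rightarrow> bool" where
  "is_norm N \<longleftrightarrow>
     (\<forall>x. 0 \<le> N x) \<and> (\<forall>x. N x = 0 \<longleftrightarrow> x = 0) \<and>
     (\<forall>r x. N (r *\<^sub>R x) = \<bar>r\<bar> * N x) \<and> (\<forall>x y. N (x + y) \<le> N x + N y)"

(* For a norm N on a Euclidean space the supremum is finite and attained. *)
definition dual_norm :: "('a::euclidean_space \<Rightarrow> real) \<Rightarrow> 'a \<Rightarrow> real" where
  "dual_norm N u = (SUP x\<in>{x. N x \<le> 1}. u \<bullet> x)"

definition norm_dist :: "('a::real_vector \<Rightarrow> real) \<Rightarrow> 'a \<Rightarrow> 'a \<Rightarrow> real" where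
  "norm_dist N x y = N (x - y)"

(* Extended-valued, so that the distance to the empty set is infinite. *)
definition dist_to_set :: "('a \<Rightarrow> 'a \<Rightarrow> real) \<Rightarrow> 'a \<Rightarrow> 'a set \<Rightarrow> ennreal" where
  "dist_to_set d x A = (INF z\<in>A. ennreal (d x z))"

definition neighborhood :: "('a \<Rightarrow> 'a \<Rightarrow> real) \<Rightarrow> 'a \<Rightarrow> 'a set \<Rightarrow> bool" where
  "neighborhood d x U \<longleftrightarrow> (\<exists>e>0. {z. d x z < e} \<subseteq> U)"

(* The metrics are explicit arguments since they come from arbitrary norms rather than
   from the type classes. The infimum is infinite if no kappa is admissible. *)
definition clm :: "('y \<Rightarrow> 'y \<Rightarrow> real) \<Rightarrow> ('x \<Rightarrow> 'x \<Rightarrow> real) \<Rightarrow> ('y \<Rightarrow> 'x set) \<Rightarrow> 'y \<Rightarrow> 'x \<Rightarrow> ennreal" where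
  "clm dY dX S ybar xbar =
     Inf {ennreal \<kappa> | \<kappa>. 0 \<le> \<kappa> \<and>
       (\<exists>U V. neighborhood dX xbar U \<and> neighborhood dY ybar V \<and>
         (\<forall>y\<in>V. \<forall>x \<in> S y \<inter> U. dist_to_set dX x (S ybar) \<le> ennreal (\<kappa> * dY y ybar)))}"

definition feasible_set :: "('t::finite \<Rightarrow> real^'p) \<Rightarrow> real^'t \<Rightarrow> (real^'p) set" where
  "feasible_set a b = {x. \<forall>t. a t \<bullet> x \<le> b $ t}"

definition solution_set :: "('t::finite \<Rightarrow> real^'p) \<Rightarrow> (real^'p) \<times> (real^'t) \<Rightarrow> (real^'p) set" where
  "solution_set a = (\<lambda>(c, b). {x \<in> feasible_set a b. \<forall>y \<in> feasible_set a b. c \<bullet> x \<le> c \<bullet> y})"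

(* On real^'t, infnorm is the maximum of the absolute values of the components (infnorm_cart). *)
definition param_norm :: "(real^'p \<Rightarrow> real) \<Rightarrow> (real^'p) \<times> (real^'t) \<Rightarrow> real" where
  "param_norm N = (\<lambda>(c, b). max (dual_norm N c) (infnorm b))"

definition active_indices :: "('t::finite \<Rightarrow> real^'p) \<Rightarrow> real^'t \<Rightarrow> real^'p \<Rightarrow> 't set" where
  "active_indices a b x = {t. a t \<bullet> x = b $ t}"

(* The convex_cone hull always contains 0, also for the empty set. *)
definition KKT_sets :: "('t::finite \<Rightarrow> real^'p) \<Rightarrow> real^'p \<Rightarrow> real^'t \<Rightarrow> real^'p \<Rightarrow> 't set set" where
  "KKT_sets a c b x =
     {D. D \<subseteq> active_indices a b x \<and> card D \<le> CARD('p) \<and> - c \<in> convex_cone hull (a ` D)}"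

definition f_fun :: "('t::finite \<Rightarrow> real^'p) \<Rightarrow> real^'t \<Rightarrow> 't set \<Rightarrow> real^'p \<Rightarrow> real" where
  "f_fun a b D x = Sup ({a t \<bullet> x - b $ t | t. True} \<union> {- (a t \<bullet> x) + b $ t | t. t \<in> D})"

definition subdifferential :: "('a::real_inner \<Rightarrow> real) \<Rightarrow> 'a \<Rightarrow> 'a set" where
  "subdifferential f x = {u. \<forall>y. f x + u \<bullet> (y - x) \<le> f y}"

end

theory Submission
  imports Defs
begin

text \<open>
  For \<open>c\<close> close to \<open>cbar\<close>, every cone spanned by some of the \<open>a t\<close> that contains \<open>- c\<close>
  contains \<open>- cbar\<close> as well, because there are finitely many such cones and all are closed. By
  the KKT conditions, solutions for \<open>(c, b)\<close> are then solutions for \<open>(cbar, b)\<close>, so perturbing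
  \<open>c\<close> does not increase the calmness modulus.

  For the upper bound, a solution \<open>x\<close> for \<open>(cbar, b)\<close> near \<open>xbar\<close> has, by the conic
  Caratheodory theorem, a KKT set \<open>D\<close> of at most \<open>p\<close> indices active at \<open>x\<close>, and these are active at
  \<open>xbar\<close> too. Then \<open>f_D x\<close> is at most the distance from \<open>b\<close> to \<open>bbar\<close>, while all points where
  \<open>f_D \<le> 0\<close> are solutions for \<open>(cbar, bbar)\<close>. The distance from \<open>x\<close> to these points is bounded
  by the error bound for convex functions, where minimizing \<open>max 0 (f_D y) + N (y - x) / \<kappa>\<close> over \<open>y\<close>
  produces either a point with \<open>f_D y \<le> 0\<close> or a subgradient of \<open>f_D\<close> of dual norm at most \<open>1 / \<kappa>\<close>.
\<close>

section \<open>Norms on Euclidean spaces\<close>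

lemma is_norm_minus_commute:
  assumes "is_norm N"
  shows "N (x - y) = N (y - x)"
proof -
  have "N (- 1 *\<^sub>R (y - x)) = \<bar>- 1\<bar> * N (y - x)"
    using assms unfolding is_norm_def by blast
  then show ?thesis by simp
qed

lemma is_norm_triangle:
  assumes "is_norm N"
  shows "N (x - z) \<le> N (x - y) + N (y - z)"
proof -
  have "N ((x - y) + (y - z)) \<le> N (x - y) + N (y - z)"
    using assms unfolding is_norm_def by blast
  then show ?thesis by simp
qed

lemma is_norm_nonneg: "is_norm N \<Longrightarrow> 0 \<le> N x"
  and is_norm_zero: "is_norm N \<Longrightarrow> N 0 = 0"
  and is_norm_eq_0_iff: "is_norm N \<Longrightarrow> N x = 0 \<longleftrightarrow> x = 0"
  and is_norm_scaleR: "is_norm N \<Longrightarrow> N (r *\<^sub>R x) = \<bar>r\<bar> * N x"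
  unfolding is_norm_def by auto

lemma is_norm_convex:
  assumes "is_norm N"
  shows "convex_on UNIV (\<lambda>x. N (x - c))"
proof (rule convex_onI)
  fix t :: real and x y
  assume t: "0 < t" "t < 1"
  have "(1 - t) *\<^sub>R x + t *\<^sub>R y - c = (1 - t) *\<^sub>R (x - c) + t *\<^sub>R (y - c)"
    by (simp add: algebra_simps)
  moreover have "N ((1 - t) *\<^sub>R (x - c) + t *\<^sub>R (y - c)) \<le> N ((1 - t) *\<^sub>R (x - c)) + N (t *\<^sub>R (y - c))"
    using assms unfolding is_norm_def by blast
  ultimately show "N ((1 - t) *\<^sub>R x + t *\<^sub>R y - c) \<le> (1 - t) * N (x - c) + t * N (y - c)"
    using t by (simp add: is_norm_scaleR[OF assms])
qed simp

lemma is_norm_continuous: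
  fixes N :: "'a::euclidean_space \<Rightarrow> real"
  assumes "is_norm N"
  shows "continuous_on S (\<lambda>x. N (x - c))"
  using convex_on_continuous[OF open_UNIV is_norm_convex[OF assms]] continuous_on_subset by blast

text \<open>\<open>N\<close> is continuous by convexity, so it attains a positive minimum and a
  maximum on the compact unit sphere; homogeneity extends both bounds to the whole space.\<close>

lemma is_norm_equivalent:
  fixes N :: "'a::euclidean_space \<Rightarrow> real"
  assumes "is_norm N"
  obtains m M where "0 < m" "0 < M" "\<And>x. m * norm x \<le> N x" "\<And>x. N x \<le> M * norm x"
proof -
  let ?S = "sphere (0::'a) 1"
  have ne: "?S \<noteq> {}" by simp
  have cont: "continuous_on ?S N"
    using is_norm_continuous[OF assms, of _ 0] by simp
  obtain p where p: "p \<in> ?S" "\<And>y. y \<in> ?S \<Longrightarrow> N p \<le> N y"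
    using continuous_attains_inf[OF compact_sphere ne cont] by blast
  obtain q where q: "q \<in> ?S" "\<And>y. y \<in> ?S \<Longrightarrow> N y \<le> N q"
    using continuous_attains_sup[OF compact_sphere ne cont] by blast
  have pos: "0 < N y" if "y \<in> ?S" for y
    using is_norm_nonneg[OF assms, of y] is_norm_eq_0_iff[OF assms, of y] that by fastforce
  have scale: "N x = norm x * N (x /\<^sub>R norm x)" "x /\<^sub>R norm x \<in> ?S" if "x \<noteq> 0" for x
    using that by (auto simp: is_norm_scaleR[OF assms])
  show thesis
  proof
    show "0 < N p" "0 < N q" using pos p q by auto
    show "N p * norm x \<le> N x" for x
    proof (cases "x = 0")
      case False
      then show ?thesis
        using mult_left_mono[OF p(2)[OF scale(2)] norm_ge_zero] scale(1)[of x]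
        by (metis mult.commute)
    qed (simp add: is_norm_zero[OF assms])
    show "N x \<le> N q * norm x" for x
    proof (cases "x = 0")
      case False
      then show ?thesis
        using mult_left_mono[OF q(2)[OF scale(2)] norm_ge_zero] scale(1)[of x]
        by (metis mult.commute)
    qed (simp add: is_norm_zero[OF assms])
  qed
qed

lemma is_norm_infnorm: "is_norm (infnorm :: 'a::euclidean_space \<Rightarrow> real)"
  unfolding is_norm_def
  by (simp add: infnorm_pos_le infnorm_eq_0 infnorm_mul infnorm_triangle)

text \<open>Passes from the Euclidean topology to balls of \<open>N\<close>. A lower bound suffices,
  since a small value of \<open>N\<close> then forces a small Euclidean distance; this covers
  \<open>dual_norm N\<close> too.\<close>

lemma eventually_nhds_norm_ball:
  fixes N :: "'a::euclidean_space \<Rightarrow> real"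
  assumes "0 < m" "\<And>x. m * norm x \<le> N x" "eventually P (nhds x)"
  obtains e where "0 < e" "\<And>z. N (x - z) < e \<Longrightarrow> P z"
proof -
  obtain d where d: "0 < d" "\<And>z. dist z x < d \<Longrightarrow> P z"
    using assms(3) unfolding eventually_nhds_metric by blast
  show thesis
  proof
    show "0 < m * d" using d assms by simp
    show "P z" if "N (x - z) < m * d" for z
    proof (rule d(2))
      have "m * norm (x - z) < m * d" using assms(2) that by (meson le_less_trans)
      then show "dist z x < d" using assms(1) by (simp add: dist_norm norm_minus_commute)
    qed
  qed
qed

text \<open>Boundedness gives the real-valued \<open>SUP\<close> in \<open>dual_norm\<close> its
  meaning. The \<open>N\<close>-unit ball is Euclidean bounded, so Cauchy-Schwarz applies.\<close>

lemma bdd_above_dual_norm: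
  fixes N :: "'a::euclidean_space \<Rightarrow> real"
  assumes "is_norm N"
  shows "bdd_above ((\<lambda>x. u \<bullet> x) ` {x. N x \<le> 1})"
proof -
  obtain m where m: "0 < m" "\<And>x. m * norm x \<le> N x"
    using is_norm_equivalent[OF assms] by metis
  show ?thesis
  proof (rule bdd_aboveI2)
    fix x assume "x \<in> {x. N x \<le> 1}"
    then have "m * norm x \<le> 1" using m(2)[of x] by simp
    then have "norm x \<le> 1 / m" using m(1) by (simp add: field_simps)
    then have "norm u * norm x \<le> norm u * (1 / m)" by (rule mult_left_mono) simp
    then show "u \<bullet> x \<le> norm u * (1 / m)" using norm_cauchy_schwarz order_trans by blast
  qed
qed

lemma dual_norm_lower_bound:
  fixes N :: "'a::euclidean_space \<Rightarrow> real"
  assumes "is_norm N"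
  obtains m where "0 < m" "\<And>u. m * norm u \<le> dual_norm N u"
proof -
  obtain M where M: "0 < M" "\<And>x. N x \<le> M * norm x"
    using is_norm_equivalent[OF assms] by metis
  have "1 / M * norm u \<le> dual_norm N u" for u
  proof -
    \<comment> \<open>The test vector is \<open>u\<close> itself, scaled into the
      \<open>N\<close>-unit ball; for \<open>u = 0\<close> it is \<open>0\<close>.\<close>
    let ?x = "u /\<^sub>R (M * norm u)"
    have "N ?x = N u / (M * norm u)"
      using M(1) by (simp add: is_norm_scaleR[OF assms] divide_inverse abs_mult)
    also have "\<dots> \<le> 1"
      using M by (cases "u = 0") (simp_all add: divide_le_eq)
    finally have "u \<bullet> ?x \<le> dual_norm N u"
      unfolding dual_norm_def by (intro cSUP_upper bdd_above_dual_norm assms) simp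
    moreover have "u \<bullet> ?x = 1 / M * norm u"
      by (cases "u = 0") (simp_all add: dot_square_norm power2_eq_square field_simps)
    ultimately show ?thesis by simp
  qed
  then show thesis using that M(1) by (metis divide_pos_pos zero_less_one)
qed

lemma dual_norm_le:
  fixes N :: "'a::euclidean_space \<Rightarrow> real"
  assumes "is_norm N" "0 \<le> k" "\<And>h. u \<bullet> h \<le> k * N h"
  shows "dual_norm N u \<le> k"
  unfolding dual_norm_def
proof (rule cSUP_least)
  show "{x. N x \<le> 1} \<noteq> {}"
    using is_norm_zero[OF assms(1)] by (auto intro!: exI[of _ 0])
  fix x assume "x \<in> {x. N x \<le> 1}"
  then have "k * N x \<le> k * 1" using assms(2) by (intro mult_left_mono) auto
  then show "u \<bullet> x \<le> k" using assms(3)[of x] by simp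
qed

lemma dual_norm_zero:
  assumes "is_norm N"
  shows "dual_norm N 0 = 0"
proof -
  have "0 \<in> {x. N x \<le> 1}" by (simp add: is_norm_zero[OF assms])
  then have "{x. N x \<le> 1} \<noteq> {}" by blast
  then show ?thesis unfolding dual_norm_def by simp
qed

section \<open>Subgradients and the error bound\<close>

text \<open>Separates the strict epigraph of \<open>f\<close> from the hypograph of the concave
  function \<open>f y - k * N (w - y)\<close>; the slope of the hyperplane is the subgradient. The
  sign in \<open>- u\<close> fits the distance from \<open>0\<close> to \<open>u\<close>, which is
  \<open>dual_norm N (0 - u)\<close>.\<close>

lemma convex_minimum_perturbed_by_norm:
  fixes f N :: "'a::euclidean_space \<Rightarrow> real"
  assumes f: "convex_on UNIV f" and N: "is_norm N" and k: "0 \<le> k"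
    and min: "\<And>w. f y \<le> f w + k * N (w - y)"
  obtains u where "u \<in> subdifferential f y" "dual_norm N (- u) \<le> k"
proof -
  let ?S = "{p. snd p \<le> f y - k * N (fst p - y)}" and ?T = "{p. f (fst p) < snd p}"
  have "convex ?S"
  proof (rule convexI)
    fix p q :: "'a \<times> real" and s t :: real
    assume pq: "p \<in> ?S" "q \<in> ?S" and st: "0 \<le> s" "0 \<le> t" "s + t = 1"
    have "N ((s *\<^sub>R fst p + t *\<^sub>R fst q) - y) \<le> s * N (fst p - y) + t * N (fst q - y)"
      using is_norm_convex[OF N, of y] st unfolding convex_on_def by simp
    then have 1: "k * N ((s *\<^sub>R fst p + t *\<^sub>R fst q) - y) \<le> k * (s * N (fst p - y) + t * N (fst q - y))"
      using k by (rule mult_left_mono)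
    have 2: "s * snd p \<le> s * (f y - k * N (fst p - y))" "t * snd q \<le> t * (f y - k * N (fst q - y))"
      using pq st by (auto intro: mult_left_mono)
    have "s * f y + t * f y = f y" using st by (metis distrib_right mult_1)
    then show "s *\<^sub>R p + t *\<^sub>R q \<in> ?S" using 1 2 by (simp add: algebra_simps)
  qed
  moreover have "convex ?T"
  proof (rule convexI)
    fix p q :: "'a \<times> real" and s t :: real
    assume pq: "p \<in> ?T" "q \<in> ?T" and st: "0 \<le> s" "0 \<le> t" "s + t = 1"
    have 1: "f (s *\<^sub>R fst p + t *\<^sub>R fst q) \<le> s * f (fst p) + t * f (fst q)"
      using f st unfolding convex_on_def by simp
    have "s * f (fst p) + t * f (fst q) < s * snd p + t * snd q"
    \<comment> \<open>Multiplying a strict inequality by \<open>s\<close> loses strictness when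
      \<open>s = 0\<close>; in that case \<open>t = 1\<close>.\<close>
    proof (cases "s = 0")
      case True
      then show ?thesis using pq st by simp
    next
      case False
      then have "s * f (fst p) < s * snd p" using pq st by simp
      moreover have "t * f (fst q) \<le> t * snd q" using pq st by (simp add: mult_left_mono)
      ultimately show ?thesis by simp
    qed
    then show "s *\<^sub>R p + t *\<^sub>R q \<in> ?T" using 1 by simp
  qed
  moreover have "(y, f y) \<in> ?S" "(y, f y + 1) \<in> ?T" by (simp_all add: is_norm_zero[OF N])
  moreover have "?S \<inter> ?T = {}"
  proof -
    have False if "snd p \<le> f y - k * N (fst p - y)" "f (fst p) < snd p" for p
      using min[of "fst p"] that by linarith
    then show ?thesis by blast
  qed
  ultimately obtain q \<beta> where q: "q \<noteq> 0" "\<And>p. p \<in> ?S \<Longrightarrow> q \<bullet> p \<le> \<beta>" "\<And>p. p \<in> ?T \<Longrightarrow> q \<bullet> p \<ge> \<beta>"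
    using separating_hyperplane_sets[of ?S ?T] by blast
  obtain v \<tau> where vt: "q = (v, \<tau>)" by fastforce
  have S: "v \<bullet> w + \<tau> * s \<le> \<beta>" if "s \<le> f y - k * N (w - y)" for w s
    using q(2)[of "(w, s)"] that vt by simp
  have T: "v \<bullet> w + \<tau> * s \<ge> \<beta>" if "s > f w" for w s
    using q(3)[of "(w, s)"] that vt by simp
  have S0: "v \<bullet> y + \<tau> * f y \<le> \<beta>" using S[of "f y" y] by (simp add: is_norm_zero[OF N])
  have "\<tau> \<ge> 0" using S0 T[of y "f y + 1"] by (simp add: algebra_simps)
  \<comment> \<open>The hyperplane is not vertical: both sets project onto the whole space, so for
    \<tau> = 0 the functional given by \<open>v\<close> would be constant, hence zero.\<close>
  moreover have "\<tau> \<noteq> 0"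
  proof
    assume \<tau>: "\<tau> = 0"
    have "v \<bullet> w = \<beta>" for w using S[OF order_refl, of w] T[of w "f w + 1"] \<tau> by simp
    from this[of 0] this[of v] have "v = 0" by simp
    with vt \<tau> q(1) show False by (simp add: zero_prod_def)
  qed
  ultimately have \<tau>: "\<tau> > 0" by simp
  \<comment> \<open>The strict epigraph yields the inequality only above \<open>f w\<close>; a limit
    reaches \<open>f w\<close> itself.\<close>
  have T': "v \<bullet> w + \<tau> * f w \<ge> \<beta>" for w
  proof (rule field_le_epsilon)
    fix e :: real assume "0 < e"
    then show "\<beta> \<le> v \<bullet> w + \<tau> * f w + e"
      using T[of w "f w + e / \<tau>"] \<tau> by (simp add: algebra_simps)
  qed
  have beta: "\<beta> = v \<bullet> y + \<tau> * f y" using S0 T'[of y] by simp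
  define u where "u = - (v /\<^sub>R \<tau>)"
  have vu: "v = - (\<tau> *\<^sub>R u)" using \<tau> by (simp add: u_def)
  show thesis
  proof
    show "u \<in> subdifferential f y"
      unfolding subdifferential_def
    proof (intro CollectI allI)
      fix w
      have "\<tau> * (f y + u \<bullet> (w - y)) \<le> \<tau> * f w"
        using T'[of w] unfolding beta vu by (simp add: algebra_simps)
      then show "f y + u \<bullet> (w - y) \<le> f w" using \<tau> by simp
    qed
    show "dual_norm N (- u) \<le> k"
    proof (rule dual_norm_le[OF N k])
      fix h
      have "\<tau> * (- u \<bullet> h) \<le> \<tau> * (k * N h)"
        using S[OF order_refl, of "y + h"] unfolding beta vu by (simp add: algebra_simps)
      then show "- u \<bullet> h \<le> k * N h" using \<tau> by (simp only: mult_le_cancel_left_pos)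
    qed
  qed
qed

text \<open>A finite-dimensional Ekeland argument, where compactness makes the penalized minimum
  attained. The slope condition is imposed only on the ball where the minimizer must lie, so a bound
  valid near one point can supply it.\<close>

lemma convex_error_bound:
  fixes f N :: "'a::euclidean_space \<Rightarrow> real"
  assumes f: "convex_on UNIV f" and N: "is_norm N" and \<kappa>: "0 < \<kappa>"
    and slope: "\<And>y. 0 < f y \<Longrightarrow> N (y - x) \<le> \<kappa> * max 0 (f x) \<Longrightarrow>
      1 / dist_to_set (norm_dist (dual_norm N)) 0 (subdifferential f y) < ennreal \<kappa>"
  shows "\<exists>y. f y \<le> 0 \<and> N (y - x) \<le> \<kappa> * max 0 (f x)"
proof -
  define g where "g w = max 0 (f w) + N (w - x) / \<kappa>" for w
  let ?K = "{w. N (w - x) \<le> \<kappa> * max 0 (f x)}"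
  have contf: "continuous_on UNIV f" by (rule convex_on_continuous[OF open_UNIV f])
  obtain m where m: "0 < m" "\<And>x. m * norm x \<le> N x"
    using is_norm_equivalent[OF N] by metis
  have "?K \<subseteq> cball x (\<kappa> * max 0 (f x) / m)"
  proof
    fix w assume "w \<in> ?K"
    then have "m * norm (w - x) \<le> \<kappa> * max 0 (f x)" using m(2)[of "w - x"] by simp
    then show "w \<in> cball x (\<kappa> * max 0 (f x) / m)"
      using m(1) by (simp add: dist_norm norm_minus_commute pos_le_divide_eq mult.commute)
  qed
  then have "bounded ?K" using bounded_cball bounded_subset by blast
  moreover have "closed ?K"
    by (intro closed_Collect_le is_norm_continuous[OF N] continuous_on_const)
  ultimately have "compact ?K" by (simp add: compact_eq_bounded_closed)
  moreover have xK: "x \<in> ?K" using \<kappa> by (simp add: is_norm_zero[OF N])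
  moreover have "continuous_on ?K g"
    unfolding g_def
    by (intro continuous_intros is_norm_continuous[OF N] continuous_on_subset[OF contf])
       (use \<kappa> in auto)
  ultimately obtain y where y: "y \<in> ?K" "\<And>w. w \<in> ?K \<Longrightarrow> g y \<le> g w"
    using continuous_attains_inf[of ?K g] by blast
  \<comment> \<open>Outside \<open>?K\<close> the penalty \<open>N (w - x) / \<kappa>\<close> alone
    is at least \<open>g x\<close>, so the minimum over \<open>?K\<close> is global.\<close>
  have min: "g y \<le> g w" for w
  proof (cases "w \<in> ?K")
    case False
    then have "\<kappa> * max 0 (f x) \<le> N (w - x)" by simp
    then have "max 0 (f x) \<le> N (w - x) / \<kappa>"
      by (simp only: pos_le_divide_eq[OF \<kappa>] mult.commute)
    moreover have "g x = max 0 (f x)" "N (w - x) / \<kappa> \<le> g w"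
      by (simp_all add: g_def is_norm_zero[OF N])
    ultimately show ?thesis using y(2)[OF xK] by linarith
  qed (use y in blast)
  have "f y \<le> 0"
  proof (rule ccontr)
    assume pos: "\<not> f y \<le> 0"
    let ?f = "\<lambda>w. max 0 (f w)"
    \<comment> \<open>The triangle inequality recentres the penalty from \<open>x\<close> to
      \<open>y\<close>.\<close>
    have loc: "?f y \<le> ?f w + 1 / \<kappa> * N (w - y)" for w
    proof -
      have "N (w - x) / \<kappa> \<le> N (w - y) / \<kappa> + N (y - x) / \<kappa>"
        using divide_right_mono[OF is_norm_triangle[OF N, of w x y], of \<kappa>] \<kappa>
        by (simp add: add_divide_distrib)
      then show ?thesis using min[of w] \<kappa> by (simp add: g_def del: max.bounded_iff)
    qed
    have fmin: "f y \<le> f w + 1 / \<kappa> * N (w - y)" for w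
    proof -
      \<comment> \<open>Near \<open>y\<close> the truncation is inactive; convexity carries the inequality to all \<open>w\<close>.\<close>
      have "isCont (\<lambda>t::real. f (y + t *\<^sub>R (w - y))) 0"
        using continuous_on_compose2[OF contf, of UNIV "\<lambda>t::real. y + t *\<^sub>R (w - y)"]
        by (auto intro!: continuous_intros simp: continuous_on_eq_continuous_at)
      then have "((\<lambda>t::real. f (y + t *\<^sub>R (w - y))) \<longlongrightarrow> f y) (at 0)"
        by (simp add: isCont_def)
      then have "\<forall>\<^sub>F t::real in at 0. 0 < f (y + t *\<^sub>R (w - y))"
        using pos by (intro order_tendstoD) auto
      then obtain d where d: "0 < d" "\<And>t::real. t \<noteq> 0 \<Longrightarrow> \<bar>t\<bar> < d \<Longrightarrow> 0 < f (y + t *\<^sub>R (w - y))"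
        unfolding eventually_at by (auto simp: dist_real_def)
      define t where "t = min (d / 2) 1"
      have t: "0 < t" "t \<le> 1" "\<bar>t\<bar> < d" using d by (auto simp: t_def)
      let ?z = "y + t *\<^sub>R (w - y)"
      have "?z = (1 - t) *\<^sub>R y + t *\<^sub>R w" by (simp add: algebra_simps)
      then have "f ?z \<le> (1 - t) * f y + t * f w"
        using f t unfolding convex_on_def by simp
      moreover have "f y \<le> f ?z + 1 / \<kappa> * (t * N (w - y))"
        using loc[of ?z] d(2)[of t] t pos by (simp add: is_norm_scaleR[OF N])
      ultimately have "t * f y \<le> t * (f w + 1 / \<kappa> * N (w - y))"
        by (simp add: algebra_simps)
      then show ?thesis using t by simp
    qed
    obtain u where u: "u \<in> subdifferential f y" "dual_norm N (- u) \<le> 1 / \<kappa>"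
      using convex_minimum_perturbed_by_norm[OF f N _ fmin] \<kappa> by auto
    let ?d = "dist_to_set (norm_dist (dual_norm N)) 0 (subdifferential f y)"
    have "?d \<le> ennreal (norm_dist (dual_norm N) 0 u)"
      unfolding dist_to_set_def by (rule INF_lower[OF u(1)])
    also have "\<dots> \<le> ennreal (1 / \<kappa>)"
      using u(2) by (simp add: norm_dist_def ennreal_leI)
    finally have d: "?d \<le> ennreal (1 / \<kappa>)" .
    have "1 / ?d < ennreal \<kappa>"
      using slope[of y] y(1) pos by simp
    \<comment> \<open>In \<open>ennreal\<close>, \<open>1 / 0\<close> is \<open>top\<close>, which
      the strict bound excludes.\<close>
    moreover have "?d \<noteq> 0" using calculation by auto
    moreover have "?d < top" using d le_less_trans ennreal_less_top by blast
    ultimately have "1 < ennreal \<kappa> * ?d" by (simp add: divide_less_ennreal)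
    also have "\<dots> \<le> ennreal \<kappa> * ennreal (1 / \<kappa>)" using d by (rule mult_left_mono) simp
    also have "\<dots> = 1" using \<kappa> by (simp flip: ennreal_mult')
    finally show False by simp
  qed
  then show ?thesis using y(1) by blast
qed

section \<open>Conic Caratheodory theorem and KKT conditions\<close>

lemma convex_cone_hull_finite_sum:
  assumes "finite S" "x \<in> convex_cone hull S"
  obtains u where "\<And>v. v \<in> S \<Longrightarrow> 0 \<le> u v" "x = (\<Sum>v\<in>S. u v *\<^sub>R v)"
proof -
  consider "x = 0" | y c where "y \<in> convex hull S" "0 \<le> c" "x = c *\<^sub>R y"
    using assms(2) unfolding convex_cone_hull_convex_hull by auto
  then show thesis
  proof cases
    case 1
    then show thesis using that[of "\<lambda>_. 0"] by simp
  next
    case 2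
    then obtain u where "\<And>v. v \<in> S \<Longrightarrow> 0 \<le> u v" "y = (\<Sum>v\<in>S. u v *\<^sub>R v)"
      unfolding convex_hull_finite[OF assms(1)] by auto
    then show thesis using that[of "\<lambda>v. c * u v"] 2 by (simp add: scaleR_sum_right)
  qed
qed

lemma sum_in_convex_cone_hull:
  assumes "\<And>v. v \<in> S \<Longrightarrow> 0 \<le> u v"
  shows "(\<Sum>v\<in>S. u v *\<^sub>R v) \<in> convex_cone hull S"
proof -
  have "(\<Sum>v\<in>T. u v *\<^sub>R v) \<in> convex_cone hull S" if "T \<subseteq> S" for T
    using that
  proof (induction T rule: infinite_finite_induct)
    case (insert v T)
    then show ?case
      using assms by (simp add: convex_cone_hull_add convex_cone_hull_mul hull_inc)
  qed (auto simp: convex_cone_hull_contains_0)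
  then show ?thesis by simp
qed

lemma convex_cone_hull_caratheodory:
  assumes "finite S" "x \<in> convex_cone hull S"
  obtains T where "T \<subseteq> S" "independent T" "x \<in> convex_cone hull T"
proof -
  have "\<exists>T\<subseteq>S. independent T \<and> x \<in> convex_cone hull T"
    using assms
  proof (induction S rule: finite_psubset_induct)
    case (psubset S)
    show ?case
    proof (cases "independent S")
      case True
      then show ?thesis using psubset.prems by blast
    next
      case False
      then obtain w v where "v \<in> S" "w v \<noteq> 0" and w0: "(\<Sum>v\<in>S. w v *\<^sub>R v) = 0"
        using real_vector.dependent_finite[OF psubset.hyps] by blast
      then obtain \<mu> where mu: "\<exists>v\<in>S. 0 < \<mu> v" "(\<Sum>v\<in>S. \<mu> v *\<^sub>R v) = 0"
      \<comment> \<open>The dependency is negated if necessary, so that some coefficient is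
        positive.\<close>
      proof (cases "w v > 0")
        case False
        have "(\<Sum>v\<in>S. (- w v) *\<^sub>R v) = 0" using w0 by (simp add: sum_negf)
        then show thesis using that[of "\<lambda>v. - w v"] \<open>v \<in> S\<close> \<open>w v \<noteq> 0\<close> False by force
      qed blast
      obtain u where u: "\<And>v. v \<in> S \<Longrightarrow> 0 \<le> u v" "x = (\<Sum>v\<in>S. u v *\<^sub>R v)"
        using convex_cone_hull_finite_sum[OF psubset.hyps psubset.prems] by blast
      let ?P = "{v \<in> S. 0 < \<mu> v}"
      have P: "finite ?P" "?P \<noteq> {}" using psubset.hyps mu(1) by auto
      \<comment> \<open>The minimal ratio is the largest multiple of \<mu> that can be subtracted
        without making a coefficient negative; the coefficient at \<open>z\<close> becomes
        zero.\<close>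
      define z where "z = arg_min_on (\<lambda>v. u v / \<mu> v) ?P"
      have z: "z \<in> ?P" "\<And>v. v \<in> ?P \<Longrightarrow> u z / \<mu> z \<le> u v / \<mu> v"
        unfolding z_def by (rule arg_min_if_finite[OF P], rule arg_min_least[OF P])
      define r where "r = u z / \<mu> z"
      have nonneg: "0 \<le> u v - r * \<mu> v" if v: "v \<in> S" for v
      proof (cases "0 < \<mu> v")
        case True
        then have "r \<le> u v / \<mu> v" using z(2) v by (auto simp: r_def)
        then show ?thesis using True by (simp add: pos_le_divide_eq)
      next
        case False
        have "0 \<le> r" using z(1) u(1)[of z] by (simp add: r_def)
        then have "r * \<mu> v \<le> 0" using False by (simp add: mult_nonneg_nonpos)
        then show ?thesis using u(1)[OF v] by linarith
      qed
      have "x = (\<Sum>v\<in>S. (u v - r * \<mu> v) *\<^sub>R v)"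
      proof -
        have "(\<Sum>v\<in>S. (u v - r * \<mu> v) *\<^sub>R v) = (\<Sum>v\<in>S. u v *\<^sub>R v) - r *\<^sub>R (\<Sum>v\<in>S. \<mu> v *\<^sub>R v)"
          by (simp add: scaleR_left_diff_distrib sum_subtractf scaleR_sum_right)
        then show ?thesis using u(2) mu(2) by simp
      qed
      also have "\<dots> = (\<Sum>v\<in>S - {z}. (u v - r * \<mu> v) *\<^sub>R v)"
        using z(1) psubset.hyps by (intro sum.mono_neutral_right) (auto simp: r_def)
      also have "\<dots> \<in> convex_cone hull (S - {z})"
        by (rule sum_in_convex_cone_hull) (use nonneg in auto)
      finally show ?thesis
        using psubset.IH[of "S - {z}"] z(1) by blast
    qed
  qed
  then show thesis using that by blast
qed

text \<open>As \<open>a\<close> may repeat vectors, one index is chosen per vector of the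
  independent set, so the dimension bounds the number of indices as well.\<close>

lemma convex_cone_hull_image_caratheodory:
  fixes a :: "'t \<Rightarrow> 'a::euclidean_space"
  assumes "finite I" "x \<in> convex_cone hull (a ` I)"
  obtains D where "D \<subseteq> I" "card D \<le> DIM('a)" "x \<in> convex_cone hull (a ` D)"
proof -
  obtain T where T: "T \<subseteq> a ` I" "independent T" "x \<in> convex_cone hull T"
    using convex_cone_hull_caratheodory[OF finite_imageI[OF assms(1)] assms(2)] by blast
  obtain D where D: "D \<subseteq> I" "inj_on a D" "T = a ` D"
    using T(1) unfolding subset_image_inj by blast
  show thesis
    using that[of D] D T independent_bound[OF T(2)] by (simp add: card_image)
qed

text \<open>A Farkas argument: if the closed cone misses \<open>- c\<close>, a separating
  \<open>g\<close> makes \<open>- g\<close> a feasible descent direction at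
  \<open>x\<close>.\<close>

lemma KKT_necessary:
  fixes a :: "'t::finite \<Rightarrow> real^'p"
  assumes x: "x \<in> solution_set a (c, b)"
  shows "- c \<in> convex_cone hull (a ` active_indices a b x)"
proof (rule ccontr)
  let ?C = "convex_cone hull (a ` active_indices a b x)"
  have feas: "a t \<bullet> x \<le> b $ t" for t
    using x by (simp add: solution_set_def feasible_set_def)
  assume "- c \<notin> ?C"
  moreover have "closed ?C" by (intro closed_convex_cone_hull) simp
  ultimately obtain g \<beta> where g: "g \<bullet> - c < \<beta>" "\<And>z. z \<in> ?C \<Longrightarrow> \<beta> < g \<bullet> z"
    using separating_hyperplane_closed_point[OF convex_convex_cone_hull] by blast
  have "\<beta> < 0" using g(2)[OF convex_cone_hull_contains_0] by simp
  then have gc: "0 < g \<bullet> c" using g(1) by simp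
  \<comment> \<open>An active \<open>a t\<close> with \<open>g \<bullet> a t < 0\<close> could be
    scaled by a positive factor to have the value \<beta> exactly, against strict
    separation.\<close>
  have ga: "0 \<le> g \<bullet> a t" if "t \<in> active_indices a b x" for t
  proof (rule ccontr)
    assume neg: "\<not> 0 \<le> g \<bullet> a t"
    have "(\<beta> / (g \<bullet> a t)) *\<^sub>R a t \<in> ?C"
      using neg \<open>\<beta> < 0\<close> that
      by (intro convex_cone_hull_mul hull_inc) (auto simp: divide_nonpos_nonpos)
    then show False using g(2) neg by fastforce
  qed
  \<comment> \<open>A short step along \<open>- g\<close> preserves active constraints by
    \<open>ga\<close> and inactive ones by continuity, while \<open>gc\<close> makes it lower the
    objective.\<close>
  have "\<forall>\<^sub>F s in at_right (0::real). a t \<bullet> (x - s *\<^sub>R g) \<le> b $ t" for t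
  proof (cases "t \<in> active_indices a b x")
    case True
    have "a t \<bullet> (x - s *\<^sub>R g) \<le> b $ t" if "0 < s" for s :: real
      using feas[of t] ga[OF True] that
      by (simp add: inner_diff_right inner_commute) (smt (verit) mult_nonneg_nonneg)
    then show ?thesis
      by (auto simp: eventually_at_right_field intro!: exI[of _ 1])
  next
    case False
    then have "a t \<bullet> (x - 0 *\<^sub>R g) < b $ t"
      using feas[of t] by (simp add: active_indices_def)
    moreover have "((\<lambda>s::real. a t \<bullet> (x - s *\<^sub>R g)) \<longlongrightarrow> a t \<bullet> (x - 0 *\<^sub>R g)) (at_right 0)"
      by (intro tendsto_intros)
    ultimately have "\<forall>\<^sub>F s in at_right (0::real). a t \<bullet> (x - s *\<^sub>R g) < b $ t"
      by (intro order_tendstoD)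
    then show ?thesis by (rule eventually_mono) simp
  qed
  then have "\<forall>\<^sub>F s in at_right (0::real). \<forall>t. a t \<bullet> (x - s *\<^sub>R g) \<le> b $ t"
    by (rule eventually_all_finite)
  then obtain s where s: "0 < (s::real)" "\<And>t. a t \<bullet> (x - s *\<^sub>R g) \<le> b $ t"
    unfolding eventually_at_right_field by (metis dense)
  then have "c \<bullet> x \<le> c \<bullet> (x - s *\<^sub>R g)"
    using x by (simp add: solution_set_def feasible_set_def)
  then show False
    using gc s(1) by (simp add: inner_diff_right inner_commute mult_le_0_iff)
qed

text \<open>For feasible \<open>y\<close>, the half-space of vectors with nonpositive product with
  \<open>y - x\<close> is a convex cone containing all \<open>a t\<close> with
  \<open>t \<in> D\<close>, hence also \<open>- c\<close>.\<close>

lemma KKT_sufficient: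
  fixes a :: "'t::finite \<Rightarrow> real^'p"
  assumes "x \<in> feasible_set a b" "D \<subseteq> active_indices a b x" "- c \<in> convex_cone hull (a ` D)"
  shows "x \<in> solution_set a (c, b)"
proof -
  have "c \<bullet> x \<le> c \<bullet> y" if y: "y \<in> feasible_set a b" for y
  proof -
    have "(y - x) \<bullet> a t \<le> 0" if "t \<in> D" for t
      using assms(2) y that
      by (auto simp: active_indices_def feasible_set_def inner_diff_right inner_commute[of "y - x"])
    then have "a ` D \<subseteq> {u. (y - x) \<bullet> u \<le> 0}" by blast
    then have "convex_cone hull (a ` D) \<subseteq> {u. (y - x) \<bullet> u \<le> 0}"
      by (rule hull_minimal) (rule convex_cone_halfspace_le)
    then have "(y - x) \<bullet> (- c) \<le> 0" using assms(3) by blast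
    then show ?thesis by (simp add: inner_diff_right inner_commute[of "y - x"])
  qed
  then show ?thesis using assms(1) by (simp add: solution_set_def)
qed

text \<open>The neighborhood of \<open>cbar\<close> is uniform in \<open>b\<close> because the cones
  depend only on the index set \<open>D\<close>.\<close>

lemma eventually_solution_set_subset:
  fixes a :: "'t::finite \<Rightarrow> real^'p"
  shows "\<forall>\<^sub>F c in nhds cbar. \<forall>b. solution_set a (c, b) \<subseteq> solution_set a (cbar, b)"
proof -
  have "\<forall>\<^sub>F c in nhds cbar. - c \<in> convex_cone hull (a ` D) \<longrightarrow> - cbar \<in> convex_cone hull (a ` D)"
    for D
  proof (cases "- cbar \<in> convex_cone hull (a ` D)")
    case False
    have "closed (convex_cone hull (a ` D))" by (intro closed_convex_cone_hull) simp
    then have "open (- (convex_cone hull (a ` D)))" by auto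
    moreover have "((\<lambda>c. - c) \<longlongrightarrow> - cbar) (nhds cbar)" by (intro tendsto_minus tendsto_ident_at filterlim_ident)
    ultimately have "\<forall>\<^sub>F c in nhds cbar. - c \<in> - (convex_cone hull (a ` D))"
      using False by (auto dest: topological_tendstoD)
    then show ?thesis by (rule eventually_mono) simp
  qed simp
  then have "\<forall>\<^sub>F c in nhds cbar. \<forall>D. - c \<in> convex_cone hull (a ` D) \<longrightarrow> - cbar \<in> convex_cone hull (a ` D)"
    by (rule eventually_all_finite)
  then show ?thesis
  proof (rule eventually_mono)
    fix c
    assume c: "\<forall>D. - c \<in> convex_cone hull (a ` D) \<longrightarrow> - cbar \<in> convex_cone hull (a ` D)"
    have "x \<in> solution_set a (cbar, b)" if x: "x \<in> solution_set a (c, b)" for x b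
    proof (rule KKT_sufficient)
      show "x \<in> feasible_set a b" using x by (simp add: solution_set_def)
      show "- cbar \<in> convex_cone hull (a ` active_indices a b x)"
        using c KKT_necessary[OF x] by blast
    qed simp
    then show "\<forall>b. solution_set a (c, b) \<subseteq> solution_set a (cbar, b)" by blast
  qed
qed

text \<open>A constraint inactive at the reference point has a nonzero residual, which stays nonzero
  nearby by joint continuity in \<open>x\<close> and \<open>b\<close>.\<close>

lemma eventually_active_indices_subset:
  fixes a :: "'t::finite \<Rightarrow> real^'p"
  shows "\<forall>\<^sub>F (x, b) in nhds xbar \<times>\<^sub>F nhds bbar. active_indices a b x \<subseteq> active_indices a bbar xbar"
proof -
  have "\<forall>\<^sub>F (x, b) in nhds xbar \<times>\<^sub>F nhds bbar. a t \<bullet> x = b $ t \<longrightarrow> a t \<bullet> xbar = bbar $ t" for t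
  proof (cases "a t \<bullet> xbar = bbar $ t")
    case False
    have "((\<lambda>p. a t \<bullet> fst p - snd p $ t) \<longlongrightarrow> a t \<bullet> xbar - bbar $ t) (nhds xbar \<times>\<^sub>F nhds bbar)"
      by (intro tendsto_intros filterlim_fst filterlim_snd)
    then have "\<forall>\<^sub>F p in nhds xbar \<times>\<^sub>F nhds bbar. a t \<bullet> fst p - snd p $ t \<noteq> 0"
      by (rule tendsto_imp_eventually_ne) (use False in simp)
    then show ?thesis by (rule eventually_mono) auto
  qed (simp add: case_prod_unfold)
  then have "\<forall>\<^sub>F p in nhds xbar \<times>\<^sub>F nhds bbar.
      \<forall>t. case p of (x, b) \<Rightarrow> a t \<bullet> x = b $ t \<longrightarrow> a t \<bullet> xbar = bbar $ t"
    by (rule eventually_all_finite)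
  then show ?thesis by (rule eventually_mono) (auto simp: active_indices_def)
qed

section \<open>The functions \<open>f_D\<close>\<close>

text \<open>The set under \<open>Sup\<close> is finite, and nonempty because the index type is
  inhabited.\<close>

lemma f_fun_le_iff:
  fixes a :: "'t::finite \<Rightarrow> real^'p"
  shows "f_fun a b D x \<le> k \<longleftrightarrow>
    (\<forall>t. a t \<bullet> x - b $ t \<le> k) \<and> (\<forall>t\<in>D. - (a t \<bullet> x) + b $ t \<le> k)"
proof -
  let ?A = "{a t \<bullet> x - b $ t | t. True} \<union> {- (a t \<bullet> x) + b $ t | t. t \<in> D}"
  have "?A = range (\<lambda>t. a t \<bullet> x - b $ t) \<union> (\<lambda>t. - (a t \<bullet> x) + b $ t) ` D" by auto
  then have "finite ?A" by simp
  moreover have "?A \<noteq> {}" by auto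
  ultimately have "Sup ?A \<le> k \<longleftrightarrow> (\<forall>s\<in>?A. s \<le> k)"
    by (intro cSup_le_iff) simp_all
  then show ?thesis unfolding f_fun_def by auto
qed

lemma f_fun_convex:
  fixes a :: "'t::finite \<Rightarrow> real^'p" and b :: "real^'t"
  shows "convex_on UNIV (f_fun a b D)"
proof (rule convex_onI)
  fix s :: real and x y :: "real^'p"
  assume s: "0 < s" "s < 1"
  let ?z = "(1 - s) *\<^sub>R x + s *\<^sub>R y" and ?f = "f_fun a b D"
  note fx = f_fun_le_iff[where a = a and b = b and D = D and x = x, THEN iffD1, OF order_refl]
  note fy = f_fun_le_iff[where a = a and b = b and D = D and x = y, THEN iffD1, OF order_refl]
  have "a t \<bullet> ?z - b $ t \<le> (1 - s) * ?f x + s * ?f y" for t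
  proof -
    have "(1 - s) * (a t \<bullet> x - b $ t) \<le> (1 - s) * ?f x" "s * (a t \<bullet> y - b $ t) \<le> s * ?f y"
      using fx fy s by (auto intro!: mult_left_mono)
    then show ?thesis by (simp add: inner_add_right algebra_simps)
  qed
  moreover have "- (a t \<bullet> ?z) + b $ t \<le> (1 - s) * ?f x + s * ?f y" if "t \<in> D" for t
  proof -
    have "(1 - s) * (- (a t \<bullet> x) + b $ t) \<le> (1 - s) * ?f x" "s * (- (a t \<bullet> y) + b $ t) \<le> s * ?f y"
      using fx fy s that by (auto intro!: mult_left_mono)
    then show ?thesis by (simp add: inner_add_right algebra_simps)
  qed
  ultimately show "?f ?z \<le> (1 - s) * ?f x + s * ?f y" unfolding f_fun_le_iff by blast
qed simp

text \<open>The two families of terms in \<open>f_D\<close> force feasibility and equality on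
  \<open>D\<close>, so \<open>D\<close> certifies optimality.\<close>

lemma f_fun_nonpos_imp_solution:
  fixes a :: "'t::finite \<Rightarrow> real^'p"
  assumes "f_fun a b D x \<le> 0" "- c \<in> convex_cone hull (a ` D)"
  shows "x \<in> solution_set a (c, b)"
proof (rule KKT_sufficient[OF _ _ assms(2)])
  show "x \<in> feasible_set a b"
    using assms(1) by (auto simp: f_fun_le_iff feasible_set_def)
  show "D \<subseteq> active_indices a b x"
    using assms(1) by (auto simp: f_fun_le_iff active_indices_def intro!: antisym)
qed

text \<open>Replacing \<open>b\<close> by \<open>bbar\<close> shifts each residual by
  \<open>b $ t - bbar $ t\<close>; the reversed terms are controlled since the residuals for
  \<open>b\<close> vanish on \<open>D\<close>.\<close>

lemma f_fun_le_infnorm: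
  fixes a :: "'t::finite \<Rightarrow> real^'p"
  assumes "x \<in> feasible_set a b" "D \<subseteq> active_indices a b x"
  shows "f_fun a bbar D x \<le> infnorm (b - bbar)"
proof -
  have "\<bar>b $ t - bbar $ t\<bar> \<le> infnorm (b - bbar)" for t
    using component_le_infnorm_cart[of "b - bbar" t] by simp
  moreover have "a t \<bullet> x \<le> b $ t" for t using assms(1) by (simp add: feasible_set_def)
  moreover have "a t \<bullet> x = b $ t" if "t \<in> D" for t
    using assms(2) that by (auto simp: active_indices_def)
  ultimately show ?thesis unfolding f_fun_le_iff by (smt (verit))
qed

section \<open>Calmness moduli\<close>

lemma dist_to_set_le:
  assumes "y \<in> A" "d x y \<le> r"
  shows "dist_to_set d x A \<le> ennreal r"
  unfolding dist_to_set_def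
  by (rule order_trans[OF INF_lower]) (use assms in \<open>auto intro: ennreal_leI\<close>)

text \<open>Both problems admit the same constants. One direction shrinks the neighborhood of
  \<open>cbar\<close> until solutions for \<open>(c, b)\<close> solve \<open>(cbar, b)\<close>; the
  other fixes \<open>c = cbar\<close>.\<close>

lemma clm_solution_set_eq:
  fixes N :: "real^'p \<Rightarrow> real" and a :: "'t::finite \<Rightarrow> real^'p"
  assumes N: "is_norm N"
  shows "clm (norm_dist (param_norm N)) dX (solution_set a) (cbar, bbar) xbar
       = clm (norm_dist infnorm) dX (\<lambda>b. solution_set a (cbar, b)) bbar xbar"
proof (rule antisym)
  obtain m where "0 < m" "\<And>u. m * norm u \<le> dual_norm N u"
    using dual_norm_lower_bound[OF N] by blast
  from eventually_nhds_norm_ball[OF this eventually_solution_set_subset]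
  obtain \<delta> where \<delta>: "0 < \<delta>"
    "\<And>c b. dual_norm N (cbar - c) < \<delta> \<Longrightarrow> solution_set a (c, b) \<subseteq> solution_set a (cbar, b)"
    by metis
  show "clm (norm_dist (param_norm N)) dX (solution_set a) (cbar, bbar) xbar
     \<le> clm (norm_dist infnorm) dX (\<lambda>b. solution_set a (cbar, b)) bbar xbar"
    unfolding clm_def
  proof (rule Inf_superset_mono, clarify)
    fix \<kappa> U V
    assume \<kappa>: "0 \<le> \<kappa>" and U: "neighborhood dX xbar U"
      and V: "neighborhood (norm_dist infnorm) bbar V"
      and calm: "\<forall>y\<in>V. \<forall>x\<in>solution_set a (cbar, y) \<inter> U.
        dist_to_set dX x (solution_set a (cbar, bbar)) \<le> ennreal (\<kappa> * norm_dist infnorm y bbar)"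
    obtain e where e: "0 < e" "\<And>b. infnorm (bbar - b) < e \<Longrightarrow> b \<in> V"
      using V by (auto simp: neighborhood_def norm_dist_def)
    let ?W = "{(c, b). dual_norm N (cbar - c) < \<delta> \<and> b \<in> V}"
    have "neighborhood (norm_dist (param_norm N)) (cbar, bbar) ?W"
      unfolding neighborhood_def
      by (intro exI[of _ "min \<delta> e"]) (use \<delta> e in \<open>auto simp: norm_dist_def param_norm_def\<close>)
    moreover have "dist_to_set dX x (solution_set a (cbar, bbar))
        \<le> ennreal (\<kappa> * norm_dist (param_norm N) y (cbar, bbar))"
      if y: "y \<in> ?W" and x: "x \<in> solution_set a y \<inter> U" for x y
    proof -
      obtain c b where cb: "y = (c, b)" "dual_norm N (cbar - c) < \<delta>" "b \<in> V" using y by auto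
      then have "x \<in> solution_set a (cbar, b) \<inter> U" using x \<delta>(2) by blast
      then have "dist_to_set dX x (solution_set a (cbar, bbar)) \<le> ennreal (\<kappa> * norm_dist infnorm b bbar)"
        using calm cb(3) by blast
      also have "\<dots> \<le> ennreal (\<kappa> * norm_dist (param_norm N) y (cbar, bbar))"
        using \<kappa> by (intro ennreal_leI mult_left_mono) (auto simp: cb norm_dist_def param_norm_def)
      finally show ?thesis .
    qed
    ultimately show "\<exists>\<kappa>'. ennreal \<kappa> = ennreal \<kappa>' \<and> 0 \<le> \<kappa>' \<and> (\<exists>U V. neighborhood dX xbar U \<and>
        neighborhood (norm_dist (param_norm N)) (cbar, bbar) V \<and>
        (\<forall>y\<in>V. \<forall>x\<in>solution_set a y \<inter> U. dist_to_set dX x (solution_set a (cbar, bbar))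
          \<le> ennreal (\<kappa>' * norm_dist (param_norm N) y (cbar, bbar))))"
      using \<kappa> U by blast
  qed
  \<comment> \<open>The embedding of \<open>b\<close> as \<open>(cbar, b)\<close> is isometric, so a
    neighborhood restricts to its slice at \<open>cbar\<close>.\<close>
  have dist: "norm_dist (param_norm N) (cbar, b) (cbar, b') = norm_dist infnorm b b'"
    for b b' :: "real^'t"
    by (simp add: norm_dist_def param_norm_def dual_norm_zero[OF N] infnorm_pos_le max_def)
  show "clm (norm_dist infnorm) dX (\<lambda>b. solution_set a (cbar, b)) bbar xbar
     \<le> clm (norm_dist (param_norm N)) dX (solution_set a) (cbar, bbar) xbar"
    unfolding clm_def
  proof (rule Inf_superset_mono, clarify)
    fix \<kappa> U V
    assume \<kappa>: "0 \<le> \<kappa>" and U: "neighborhood dX xbar U"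
      and V: "neighborhood (norm_dist (param_norm N)) (cbar, bbar) V"
      and calm: "\<forall>y\<in>V. \<forall>x\<in>solution_set a y \<inter> U. dist_to_set dX x (solution_set a (cbar, bbar))
        \<le> ennreal (\<kappa> * norm_dist (param_norm N) y (cbar, bbar))"
    let ?W = "{b. (cbar, b) \<in> V}"
    have "neighborhood (norm_dist infnorm) bbar ?W"
      using V unfolding neighborhood_def by (metis (mono_tags, lifting) dist mem_Collect_eq subset_iff)
    moreover have "\<forall>y\<in>?W. \<forall>x\<in>solution_set a (cbar, y) \<inter> U.
        dist_to_set dX x (solution_set a (cbar, bbar)) \<le> ennreal (\<kappa> * norm_dist infnorm y bbar)"
      using calm by (auto simp flip: dist)
    ultimately show "\<exists>\<kappa>'. ennreal \<kappa> = ennreal \<kappa>' \<and> 0 \<le> \<kappa>' \<and> (\<exists>U V. neighborhood dX xbar U \<and>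
        neighborhood (norm_dist infnorm) bbar V \<and> (\<forall>y\<in>V. \<forall>x\<in>solution_set a (cbar, y) \<inter> U.
          dist_to_set dX x (solution_set a (cbar, bbar)) \<le> ennreal (\<kappa>' * norm_dist infnorm y bbar)))"
      using \<kappa> U by blast
  qed
qed

lemma clm_solution_set_le:
  fixes N :: "real^'p \<Rightarrow> real" and a :: "'t::finite \<Rightarrow> real^'p"
  assumes N: "is_norm N" and \<kappa>: "0 < \<kappa>" and xbar: "xbar \<in> solution_set a (cbar, bbar)"
    and slope: "\<And>D. D \<in> KKT_sets a cbar bbar xbar \<Longrightarrow>
      Limsup (at xbar within {x. 0 < f_fun a bbar D x})
        (\<lambda>x. 1 / dist_to_set (norm_dist (dual_norm N)) 0 (subdifferential (f_fun a bbar D) x))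
      < ennreal \<kappa>"
  shows "clm (norm_dist infnorm) (norm_dist N) (\<lambda>b. solution_set a (cbar, b)) bbar xbar \<le> ennreal \<kappa>"
proof -
  let ?s = "\<lambda>D x. 1 / dist_to_set (norm_dist (dual_norm N)) 0 (subdifferential (f_fun a bbar D) x)"
  let ?K = "KKT_sets a cbar bbar xbar"
  obtain m where m: "0 < m" "\<And>x. m * norm x \<le> N x"
    using is_norm_equivalent[OF N] by metis
  obtain m' where m': "0 < m'" "\<And>b::real^'t. m' * norm b \<le> infnorm b"
    using is_norm_equivalent[OF is_norm_infnorm] by metis
  have xfeas: "xbar \<in> feasible_set a bbar" using xbar by (simp add: solution_set_def)
  have "\<forall>\<^sub>F x in nhds xbar. 0 < f_fun a bbar D x \<longrightarrow> ?s D x < ennreal \<kappa>" if D: "D \<in> ?K" for D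
  proof -
    \<comment> \<open>The limsup says nothing at \<open>xbar\<close> itself; there the implication
      holds vacuously.\<close>
    have "f_fun a bbar D xbar \<le> 0"
      using f_fun_le_infnorm[OF xfeas, of D bbar] D by (simp add: KKT_sets_def infnorm_0)
    then show ?thesis
      using Limsup_lessD[OF slope[OF D]] unfolding eventually_at_filter
      by (auto elim!: eventually_mono)
  qed
  \<comment> \<open>There are finitely many \<open>D\<close>, so one radius serves them all.\<close>
  then have "\<forall>\<^sub>F x in nhds xbar. \<forall>D\<in>?K. 0 < f_fun a bbar D x \<longrightarrow> ?s D x < ennreal \<kappa>"
    by (intro eventually_ball_finite) auto
  from eventually_nhds_norm_ball[OF m this]
  obtain r where r: "0 < r"
    "\<And>x D. N (xbar - x) < r \<Longrightarrow> D \<in> ?K \<Longrightarrow> 0 < f_fun a bbar D x \<Longrightarrow> ?s D x < ennreal \<kappa>"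
    by metis
  obtain P Q where PQ: "eventually P (nhds xbar)" "eventually Q (nhds bbar)"
    "\<And>x b. P x \<Longrightarrow> Q b \<Longrightarrow> active_indices a b x \<subseteq> active_indices a bbar xbar"
    using eventually_active_indices_subset[of a bbar xbar] unfolding eventually_prod_filter by auto
  obtain e1 where e1: "0 < e1" "\<And>x. N (xbar - x) < e1 \<Longrightarrow> P x"
    using eventually_nhds_norm_ball[OF m PQ(1)] by blast
  obtain e2 where e2: "0 < e2" "\<And>b. infnorm (bbar - b) < e2 \<Longrightarrow> Q b"
    using eventually_nhds_norm_ball[OF m' PQ(2)] by blast
  \<comment> \<open>Half of \<open>r\<close> is for the distance from \<open>xbar\<close> to
    \<open>x\<close>, half for that from \<open>x\<close> to the points of the error bound; the
    latter is at most \<kappa> times the perturbation of \<open>b\<close>, whence the division by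
    \<kappa>.\<close>
  define U where "U = {x. N (xbar - x) < min e1 (r / 2)}"
  define V where "V = {b. infnorm (bbar - b) < min e2 (r / 2 / \<kappa>)}"
  have "neighborhood (norm_dist N) xbar U"
    unfolding neighborhood_def norm_dist_def U_def
    by (intro exI[of _ "min e1 (r / 2)"]) (use e1 r in auto)
  moreover have "neighborhood (norm_dist infnorm) bbar V"
    unfolding neighborhood_def norm_dist_def V_def
    by (intro exI[of _ "min e2 (r / 2 / \<kappa>)"]) (use e2 r \<kappa> in auto)
  moreover have "dist_to_set (norm_dist N) x (solution_set a (cbar, bbar))
      \<le> ennreal (\<kappa> * norm_dist infnorm b bbar)"
    if b: "b \<in> V" and x: "x \<in> solution_set a (cbar, b) \<inter> U" for b x
  proof -
    obtain D where D: "D \<subseteq> active_indices a b x" "card D \<le> CARD('p)"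
      "- cbar \<in> convex_cone hull (a ` D)"
      using convex_cone_hull_image_caratheodory[OF finite KKT_necessary[of x a cbar b]] x by auto
    have "active_indices a b x \<subseteq> active_indices a bbar xbar"
      using PQ(3) e1(2) e2(2) b x by (simp add: U_def V_def)
    with D have DK: "D \<in> ?K" by (auto simp: KKT_sets_def)
    let ?f = "f_fun a bbar D"
    have "?f x \<le> infnorm (b - bbar)"
      using f_fun_le_infnorm D(1) x by (auto simp: solution_set_def)
    then have "max 0 (?f x) \<le> infnorm (b - bbar)" by (simp add: infnorm_pos_le)
    then have fx: "\<kappa> * max 0 (?f x) \<le> \<kappa> * infnorm (b - bbar)"
      using \<kappa> by (intro mult_left_mono) auto
    have small: "\<kappa> * infnorm (b - bbar) < r / 2"
      using b \<kappa> by (simp add: V_def infnorm_sub pos_less_divide_eq field_simps)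
    have "\<exists>y. ?f y \<le> 0 \<and> N (y - x) \<le> \<kappa> * max 0 (?f x)"
    proof (rule convex_error_bound[OF f_fun_convex N \<kappa>])
      fix y assume y: "0 < ?f y" "N (y - x) \<le> \<kappa> * max 0 (?f x)"
      have "N (xbar - y) \<le> N (xbar - x) + N (x - y)" by (rule is_norm_triangle[OF N])
      also have "\<dots> < r"
        using y(2) fx small x is_norm_minus_commute[OF N, of x y] by (simp add: U_def)
      finally show "?s D y < ennreal \<kappa>" using r(2) DK y(1) by blast
    qed
    then obtain y where y: "?f y \<le> 0" "N (y - x) \<le> \<kappa> * max 0 (?f x)" by blast
    show ?thesis
    proof (rule dist_to_set_le)
      show "y \<in> solution_set a (cbar, bbar)" by (rule f_fun_nonpos_imp_solution[OF y(1) D(3)])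
      show "norm_dist N x y \<le> \<kappa> * norm_dist infnorm b bbar"
        using y(2) fx is_norm_minus_commute[OF N, of x y] by (simp add: norm_dist_def)
    qed
  qed
  ultimately show ?thesis
    unfolding clm_def using \<kappa> by (intro Inf_lower) (auto intro!: exI[of _ \<kappa>])
qed

(* If f_D is nowhere positive arbitrarily close to xbar, the filter of the Limsup is bot, and
   the Limsup in ennreal is then 0. *)
theorem theorem7:
  fixes N :: "real^'p \<Rightarrow> real"
    and a :: "'t::finite \<Rightarrow> real^'p"
    and cbar :: "real^'p" and bbar :: "real^'t" and xbar :: "real^'p"
  assumes "is_norm N"
    and "xbar \<in> solution_set a (cbar, bbar)"
  shows "clm (norm_dist (param_norm N)) (norm_dist N) (solution_set a) (cbar, bbar) xbar
       = clm (norm_dist infnorm) (norm_dist N) (\<lambda>b. solution_set a (cbar, b)) bbar xbar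
     \<and> clm (norm_dist infnorm) (norm_dist N) (\<lambda>b. solution_set a (cbar, b)) bbar xbar
       \<le> (SUP D\<in>KKT_sets a cbar bbar xbar.
            Limsup (at xbar within {x. 0 < f_fun a bbar D x})
              (\<lambda>x. 1 / dist_to_set (norm_dist (dual_norm N)) 0 (subdifferential (f_fun a bbar D) x)))"
proof (rule conjI[OF clm_solution_set_eq[OF assms(1)] dense_ge])
  \<comment> \<open>Working with \<open>z\<close> strictly above the supremum makes each limsup
    strictly smaller than \<open>z\<close>, which yields a slope bound near \<open>xbar\<close>. A
    finite \<open>z\<close> is positive, and \<open>z = top\<close> is trivial.\<close>
  fix z
  assume z: "(SUP D\<in>KKT_sets a cbar bbar xbar.
      Limsup (at xbar within {x. 0 < f_fun a bbar D x})
        (\<lambda>x. 1 / dist_to_set (norm_dist (dual_norm N)) 0 (subdifferential (f_fun a bbar D) x))) < z"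
  show "clm (norm_dist infnorm) (norm_dist N) (\<lambda>b. solution_set a (cbar, b)) bbar xbar \<le> z"
  proof (cases z)
    case (real \<kappa>)
    have "0 < ennreal \<kappa>" using le_less_trans[OF zero_le z] real by simp
    then have "0 < \<kappa>" by simp
    moreover note assms(2)
    moreover have "Limsup (at xbar within {x. 0 < f_fun a bbar D x})
        (\<lambda>x. 1 / dist_to_set (norm_dist (dual_norm N)) 0 (subdifferential (f_fun a bbar D) x))
        < ennreal \<kappa>" if "D \<in> KKT_sets a cbar bbar xbar" for D
      using SUP_lessD[OF z that] real by simp
    ultimately show ?thesis unfolding real by (rule clm_solution_set_le[OF assms(1)])
  qed simp
qed

end
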